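(* Let $\gamma$ be a normal magnetic curve on the unit sphere $\mathbb{S}^3$ of the contact magnetic field with strength $q\neq0$ and constant contact angle $\theta$. Then $\gamma$ is periodic if and only if $$\frac{q}{\sqrt{q^2-4q\cos\theta+4}}\in\mathbb{Q}.$$
   Context: The unit sphere $\mathbb{S}^3$ is identified with $\mathrm{SU}(2)$ with the bi-invariant metric $g$ of constant curvature $1$ induced by $\langle X,Y\rangle=-\frac12\mathrm{tr}(XY)$ on $\mathfrak{su}(2)$. Let $$\mathbf{i}=\begin{pmatrix}0&\sqrt{-1}\\ \sqrt{-1}&0\end{pmatrix},\quad \mathbf{j}=\begin{pmatrix}0&-1\\1&0\end{pmatrix},\quad \mathbf{k}=\begin{pmatrix}\sqrt{-1}&0\\0&-\sqrt{-1}\end{pmatrix},$$ and let $E_1,E_2,E_3$ be the left-invariant vector fields extending $\mathbf{i},\mathbf{j},\mathbf{k}$. The standard Sasakian structure is $\xi=E_3$, $\eta=g(E_3,\cdot)$, $\varphi E_1=-E_2$, $\varphi E_2=E_1$, $\varphi E_3=0$. For a real constant $q$ (the strength), the contact magnetic field is $F_q(X,Y)=q\,g(\varphi X,Y)$. A normal magnetic curve of $F_q$ is a smooth arc-length parametrized curve $\gamma:\mathbb{R}\to\mathbb{S}^3$ with $\nabla_{\dot\gamma}\dot\gamma=q\varphi\dot\gamma$, where $\nabla$ is the Levi-Civita connection of $g$. Along such a curve $g(\dot\gamma,\xi)=\cos\theta$ is constant and $\theta$ is called the contact angle. The curve $\gamma$ is periodic if there is $\ell>0$ with $\gamma(s+\ell)=\gamma(s)$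 for all $s\in\mathbb{R}$.
   Formalization: "Periodic implies rational" is claimed only for sin θ ≠ 0, since it fails for θ = 0, q = √2, where γ is a great circle but the quotient is 1+√2; "rational implies periodic" is claimed for every θ (with quotient read as 0 if its denominator vanishes). *)

theory Defs
  imports "HOL-Analysis.Analysis"
begin

section \<open>The group SU(2) and its bi-invariant metric\<close>

type_synonym mat2 = "complex ^ 2 ^ 2"

definition adj :: "mat2 \<Rightarrow> mat2" where
  "adj A = (\<chi> i j. cnj (A $ j $ i))"

definition SU2 :: "mat2 set" where
  "SU2 = {A. A ** adj A = mat 1 \<and> det A = 1}"

definition su2 :: "mat2 set" where
  "su2 = {X. adj X = - X \<and> trace X = 0}"

definition tangent_space :: "mat2 \<Rightarrow> mat2 set" where
  "tangent_space p = {p ** X |X. X \<in> su2}"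

text \<open>The trace of a product of two elements of \<^term>\<open>su2\<close> is real.\<close>

definition ip :: "mat2 \<Rightarrow> mat2 \<Rightarrow> real" where
  "ip X Y = - (1 / 2) * Re (trace (X ** Y))"

text \<open>For \<^term>\<open>p \<in> SU2\<close> the matrix \<^term>\<open>adj p\<close> is the inverse of \<^term>\<open>p\<close>, so that
  \<^term>\<open>\<lambda>U. adj p ** U\<close> is the left translation from the tangent space at \<^term>\<open>p\<close> to \<^term>\<open>su2\<close>.\<close>

definition gmetric :: "mat2 \<Rightarrow> mat2 \<Rightarrow> mat2 \<Rightarrow> real" where
  "gmetric p U V = ip (adj p ** U) (adj p ** V)"

definition bi :: mat2 where
  "bi = vector [vector [0, \<i>], vector [\<i>, 0]]"

definition bj :: mat2 where
  "bj = vector [vector [0, - 1], vector [1, 0]]"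

definition bk :: mat2 where
  "bk = vector [vector [\<i>, 0], vector [0, - \<i>]]"

definition left_invariant_field :: "mat2 \<Rightarrow> mat2 \<Rightarrow> mat2" where
  "left_invariant_field X p = p ** X"

definition E1 :: "mat2 \<Rightarrow> mat2" where "E1 = left_invariant_field bi"
definition E2 :: "mat2 \<Rightarrow> mat2" where "E2 = left_invariant_field bj"
definition E3 :: "mat2 \<Rightarrow> mat2" where "E3 = left_invariant_field bk"

section \<open>The Levi-Civita connection\<close>

primrec C_k :: "nat \<Rightarrow> ('a::euclidean_space \<Rightarrow> 'b::real_normed_vector) \<Rightarrow> bool" where
  "C_k 0 f \<longleftrightarrow> continuous_on UNIV f"
| "C_k (Suc n) f \<longleftrightarrow>
     (\<forall>x. f differentiable at x) \<and> (\<forall>v. C_k n (\<lambda>x. frechet_derivative f (at x) v))"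

definition smooth :: "('a::euclidean_space \<Rightarrow> 'b::real_normed_vector) \<Rightarrow> bool" where
  "smooth f \<longleftrightarrow> (\<forall>n. C_k n f)"

text \<open>Smooth functions and smooth vector fields on the closed submanifold \<^term>\<open>SU2\<close> of the
  space of matrices are given by smooth extensions to all matrices; only their values on
  \<^term>\<open>SU2\<close> matter. Since the fields are tangent to \<^term>\<open>SU2\<close> there, the derivatives
  \<open>X f\<close> and the bracket \<open>[X, Y]\<close> below do not depend on the extensions at points of
  \<^term>\<open>SU2\<close>.\<close>

definition vector_field :: "(mat2 \<Rightarrow> mat2) \<Rightarrow> bool" where
  "vector_field X \<longleftrightarrow> smooth X \<and> (\<forall>p\<in>SU2. X p \<in> tangent_space p)"

definition field_deriv :: "(mat2 \<Rightarrow> mat2) \<Rightarrow> (mat2 \<Rightarrow> 'b::real_normed_vector) \<Rightarrow> mat2 \<Rightarrow> 'b" where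
  "field_deriv X f p = frechet_derivative f (at p) (X p)"

definition lie_bracket :: "(mat2 \<Rightarrow> mat2) \<Rightarrow> (mat2 \<Rightarrow> mat2) \<Rightarrow> mat2 \<Rightarrow> mat2" where
  "lie_bracket X Y p = field_deriv X Y p - field_deriv Y X p"

definition affine_connection :: "((mat2 \<Rightarrow> mat2) \<Rightarrow> (mat2 \<Rightarrow> mat2) \<Rightarrow> mat2 \<Rightarrow> mat2) \<Rightarrow> bool" where
  "affine_connection nabla \<longleftrightarrow>
     (\<forall>X Y. vector_field X \<longrightarrow> vector_field Y \<longrightarrow> vector_field (nabla X Y)) \<and>
     (\<forall>X X' Y. vector_field X \<longrightarrow> vector_field X' \<longrightarrow> vector_field Y \<longrightarrow>
        (\<forall>p\<in>SU2. nabla (\<lambda>p. X p + X' p) Y p = nabla X Y p + nabla X' Y p)) \<and>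
     (\<forall>f X Y. smooth f \<longrightarrow> vector_field X \<longrightarrow> vector_field Y \<longrightarrow>
        (\<forall>p\<in>SU2. nabla (\<lambda>p. f p *\<^sub>R X p) Y p = f p *\<^sub>R nabla X Y p)) \<and>
     (\<forall>X Y Y'. vector_field X \<longrightarrow> vector_field Y \<longrightarrow> vector_field Y' \<longrightarrow>
        (\<forall>p\<in>SU2. nabla X (\<lambda>p. Y p + Y' p) p = nabla X Y p + nabla X Y' p)) \<and>
     (\<forall>f X Y. smooth f \<longrightarrow> vector_field X \<longrightarrow> vector_field Y \<longrightarrow>
        (\<forall>p\<in>SU2. nabla X (\<lambda>p. f p *\<^sub>R Y p) p =
           field_deriv X f p *\<^sub>R Y p + f p *\<^sub>R nabla X Y p))"

definition levi_civita :: "((mat2 \<Rightarrow> mat2) \<Rightarrow> (mat2 \<Rightarrow> mat2) \<Rightarrow> mat2 \<Rightarrow> mat2) \<Rightarrow> bool" where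
  "levi_civita nabla \<longleftrightarrow>
     affine_connection nabla \<and>
     (\<forall>X Y. vector_field X \<longrightarrow> vector_field Y \<longrightarrow>
        (\<forall>p\<in>SU2. nabla X Y p - nabla Y X p = lie_bracket X Y p)) \<and>
     (\<forall>X Y Z. vector_field X \<longrightarrow> vector_field Y \<longrightarrow> vector_field Z \<longrightarrow>
        (\<forall>p\<in>SU2. field_deriv X (\<lambda>p. gmetric p (Y p) (Z p)) p =
           gmetric p (nabla X Y p) (Z p) + gmetric p (Y p) (nabla X Z p)))"

text \<open>The covariant derivative \<open>DV/dt\<close> of a vector field \<open>V = \<Sum> v\<^sub>j E\<^sub>j\<close> along \<open>c\<close>, that is
  \<open>\<Sum> (v\<^sub>j' E\<^sub>j + v\<^sub>j \<nabla>\<^bsub>c'\<^esub> E\<^sub>j)\<close> in the global orthonormal frame \<^term>\<open>E1\<close>, \<^term>\<open>E2\<close>, \<^term>\<open>E3\<close>.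
  The velocity \<open>c'(t)\<close> is extended to the left-invariant field taking this value
  at \<^term>\<open>c t\<close>; a connection does not depend on the choice of the extension.\<close>

definition covariant_derivative ::
  "((mat2 \<Rightarrow> mat2) \<Rightarrow> (mat2 \<Rightarrow> mat2) \<Rightarrow> mat2 \<Rightarrow> mat2) \<Rightarrow>
   (real \<Rightarrow> mat2) \<Rightarrow> (real \<Rightarrow> mat2) \<Rightarrow> real \<Rightarrow> mat2" where
  "covariant_derivative nabla c V t =
     (\<Sum>E\<in>{E1, E2, E3}.
        deriv (\<lambda>s. gmetric (c s) (V s) (E (c s))) t *\<^sub>R E (c t) +
        gmetric (c t) (V t) (E (c t)) *\<^sub>R
          nabla (left_invariant_field (adj (c t) ** vector_derivative c (at t))) E (c t))"

section \<open>The Sasakian structure and its magnetic curves\<close>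

definition xi :: "mat2 \<Rightarrow> mat2" where
  "xi = E3"

definition phi :: "mat2 \<Rightarrow> mat2 \<Rightarrow> mat2" where
  "phi p V = gmetric p V (E2 p) *\<^sub>R E1 p - gmetric p V (E1 p) *\<^sub>R E2 p"

text \<open>The Lorentz force of the contact magnetic field \<open>F\<^sub>q(U, V) = q g(\<phi> U, V)\<close> is \<open>q \<phi>\<close>.\<close>

definition normal_magnetic_curve ::
  "((mat2 \<Rightarrow> mat2) \<Rightarrow> (mat2 \<Rightarrow> mat2) \<Rightarrow> mat2 \<Rightarrow> mat2) \<Rightarrow> real \<Rightarrow> (real \<Rightarrow> mat2) \<Rightarrow> bool" where
  "normal_magnetic_curve nabla q c \<longleftrightarrow>
     smooth c \<and>
     (\<forall>s. c s \<in> SU2) \<and>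
     (\<forall>s. gmetric (c s) (vector_derivative c (at s)) (vector_derivative c (at s)) = 1) \<and>
     (\<forall>s. covariant_derivative nabla c (\<lambda>t. vector_derivative c (at t)) s =
        q *\<^sub>R phi (c s) (vector_derivative c (at s)))"

definition has_contact_angle :: "(real \<Rightarrow> mat2) \<Rightarrow> real \<Rightarrow> bool" where
  "has_contact_angle c \<theta> \<longleftrightarrow>
     (\<forall>s. gmetric (c s) (vector_derivative c (at s)) (xi (c s)) = cos \<theta>)"

definition periodic :: "(real \<Rightarrow> 'a) \<Rightarrow> bool" where
  "periodic c \<longleftrightarrow> (\<exists>l>0. \<forall>s. c (s + l) = c s)"

section \<open>Existence of the Levi-Civita connection\<close>

text \<open>The predicate \<^term>\<open>levi_civita\<close> is satisfiable. The witness is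
  \<open>\<nabla>\<^bsub>X\<^esub> Y = p (dy(X) + [x, y] / 2)\<close>, where \<open>x = p\<^sup>* X\<close> and \<open>y = p\<^sup>* Y\<close> are the fields in the left
  trivialization.\<close>


lemma smooth_differentiable: "smooth f \<Longrightarrow> f differentiable at x"
  unfolding smooth_def by (metis C_k.simps(2))

lemma frechet_derivative_worksI: "f differentiable at x \<Longrightarrow> (f has_derivative frechet_derivative f (at x)) (at x)"
  by (simp add: frechet_derivative_works)

lemma C_k_Suc_imp: "C_k (Suc n) f \<Longrightarrow> C_k n f"
proof (induction n arbitrary: f)
  case 0
  then show ?case
    by (simp add: continuous_on_eq_continuous_at differentiable_imp_continuous_within)
next
  case (Suc n)
  then show ?case by (metis C_k.simps(2))
qed

lemma C_k_const: "C_k n (\<lambda>x::'a::euclidean_space. c::'b::real_normed_vector)"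
  by (induction n arbitrary: c) auto

lemma C_k_linear:
  fixes f :: "'a::euclidean_space \<Rightarrow> 'b::real_normed_vector"
  assumes "bounded_linear f" shows "C_k n f"
proof (cases n)
  case 0
  then show ?thesis using assms by (simp add: linear_continuous_on)
next
  case (Suc m)
  have "(f has_derivative f) (at x)" for x
    using assms by (rule bounded_linear_imp_has_derivative)
  moreover from this have "frechet_derivative f (at x) = f" for x
    by (metis frechet_derivative_at)
  ultimately show ?thesis unfolding Suc by (auto simp: differentiable_def C_k_const)
qed

lemma C_k_add:
  fixes f g :: "'a::euclidean_space \<Rightarrow> 'b::real_normed_vector"
  shows "C_k n f \<Longrightarrow> C_k n g \<Longrightarrow> C_k n (\<lambda>x. f x + g x)"
proof (induction n arbitrary: f g)
  case 0 then show ?case by (simp add: continuous_on_add)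
next
  case (Suc n)
  have d: "f differentiable at x" "g differentiable at x" for x using Suc.prems by auto
  have "((\<lambda>x. f x + g x) has_derivative
     (\<lambda>v. frechet_derivative f (at x) v + frechet_derivative g (at x) v)) (at x)" for x
    using d[of x, THEN frechet_derivative_worksI] by (rule has_derivative_add)
  then have "frechet_derivative (\<lambda>x. f x + g x) (at x) =
     (\<lambda>v. frechet_derivative f (at x) v + frechet_derivative g (at x) v)" for x
    by (metis frechet_derivative_at)
  then show ?case using Suc d by auto
qed

lemma C_k_sum:
  fixes f :: "'i \<Rightarrow> 'a::euclidean_space \<Rightarrow> 'b::real_normed_vector"
  shows "(\<And>i. i \<in> A \<Longrightarrow> C_k n (f i)) \<Longrightarrow> C_k n (\<lambda>x. \<Sum>i\<in>A. f i x)"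
  by (induction A rule: infinite_finite_induct) (auto simp: C_k_const intro: C_k_add)

lemma C_k_bilinear:
  fixes f :: "'a::euclidean_space \<Rightarrow> 'b::real_normed_vector" 
    and g :: "'a \<Rightarrow> 'c::real_normed_vector"
    and B :: "'b \<Rightarrow> 'c \<Rightarrow> 'd::real_normed_vector"
  assumes B: "bounded_bilinear B"
  shows "C_k n f \<Longrightarrow> C_k n g \<Longrightarrow> C_k n (\<lambda>x. B (f x) (g x))"
proof (induction n arbitrary: f g)
  case 0 then show ?case by (simp add: bounded_bilinear.continuous_on[OF B])
next
  case (Suc n)
  have d: "f differentiable at x" "g differentiable at x" for x using Suc.prems by auto
  have h: "((\<lambda>x. B (f x) (g x)) has_derivative
     (\<lambda>v. B (f x) (frechet_derivative g (at x) v) + B (frechet_derivative f (at x) v) (g x))) (at x)" for x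
    using d[of x, THEN frechet_derivative_worksI] by (rule bounded_bilinear.FDERIV[OF B])
  have "frechet_derivative (\<lambda>x. B (f x) (g x)) (at x) =
     (\<lambda>v. B (f x) (frechet_derivative g (at x) v) + B (frechet_derivative f (at x) v) (g x))" for x
    by (rule frechet_derivative_at[OF h, symmetric])
  note e = this
  have n: "C_k n f" "C_k n g" using Suc.prems by (auto intro: C_k_Suc_imp simp del: C_k.simps)
  have v: "C_k n (\<lambda>x. frechet_derivative f (at x) v)" "C_k n (\<lambda>x. frechet_derivative g (at x) v)" for v
    using Suc.prems by simp_all
  have "(\<lambda>x. B (f x) (g x)) differentiable at x" for x using h unfolding differentiable_def by blast
  then show ?case unfolding C_k.simps e
    using C_k_add[OF Suc.IH[OF n(1) v(2)] Suc.IH[OF v(1) n(2)]] by blast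
qed

lemma C_k_compose_linear:
  fixes f :: "'a::euclidean_space \<Rightarrow> 'b::real_normed_vector"
  assumes L: "bounded_linear L"
  shows "C_k n f \<Longrightarrow> C_k n (\<lambda>x. L (f x))"
proof (induction n arbitrary: f)
  case 0 then show ?case by (simp add: bounded_linear.continuous_on[OF L])
next
  case (Suc n)
  have d: "f differentiable at x" for x using Suc.prems by auto
  have h: "((\<lambda>x. L (f x)) has_derivative (\<lambda>v. L (frechet_derivative f (at x) v))) (at x)" for x
    using d[of x, THEN frechet_derivative_worksI] by (rule bounded_linear.has_derivative[OF L])
  have "frechet_derivative (\<lambda>x. L (f x)) (at x) = (\<lambda>v. L (frechet_derivative f (at x) v))" for x
    by (rule frechet_derivative_at[OF h, symmetric])
  then have e: "frechet_derivative (\<lambda>x. L (f x)) (at x) = (\<lambda>v. L (frechet_derivative f (at x) v))" for x .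
  have "(\<lambda>x. L (f x)) differentiable at x" for x using h unfolding differentiable_def by blast
  then show ?case unfolding C_k.simps e using Suc by simp
qed

lemma C_k_directional:
  fixes f :: "'a::euclidean_space \<Rightarrow> 'b::real_normed_vector"
  assumes "C_k (Suc n) f" "C_k n X"
  shows "C_k n (\<lambda>x. frechet_derivative f (at x) (X x))"
proof -
  have "frechet_derivative f (at x) (X x) = (\<Sum>b\<in>Basis. (X x \<bullet> b) *\<^sub>R frechet_derivative f (at x) b)" for x
  proof -
    have "linear (frechet_derivative f (at x))" using assms(1) by (auto intro: linear_frechet_derivative)
    then show ?thesis 
      by (subst euclidean_representation[of "X x", symmetric]) (simp only: linear_sum linear_cmul)
  qed
  moreover have "C_k n (\<lambda>x. \<Sum>b\<in>Basis. (X x \<bullet> b) *\<^sub>R frechet_derivative f (at x) b)"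
    using assms 
    by (intro C_k_sum C_k_bilinear[OF bounded_bilinear_scaleR] C_k_compose_linear[OF bounded_linear_inner_left]) auto
  ultimately show ?thesis by simp
qed

lemma mat2_eq: "A = B \<longleftrightarrow> A$1$1 = B$1$1 \<and> A$1$2 = B$1$2 \<and> A$2$1 = B$2$1 \<and> A$2$2 = B$2$2"
  for A B :: mat2
  by (auto simp: vec_eq_iff forall_2)

lemma mat2_mult_nth [simp]: "(A ** B) $ i $ j = A$i$1 * B$1$j + A$i$2 * B$2$j" for A B :: mat2
  by (simp add: matrix_matrix_mult_def sum_2)

lemma adj_nth [simp]: "adj A $ i $ j = cnj (A $ j $ i)" by (simp add: adj_def)

lemma trace_mat2: "trace A = A$1$1 + A$2$2" for A :: mat2 by (simp add: trace_def sum_2)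

lemma mat2_one_nth [simp]: "(mat 1 :: mat2) $1$1 = 1" "(mat 1 :: mat2) $1$2 = 0" 
   "(mat 1 :: mat2) $2$1 = 0" "(mat 1 :: mat2) $2$2 = 1" by (auto simp: mat_def)

lemma basis_nth [simp]: "bi$1$1 = 0" "bi$1$2 = \<i>" "bi$2$1 = \<i>" "bi$2$2 = 0"
  "bj$1$1 = 0" "bj$1$2 = -1" "bj$2$1 = 1" "bj$2$2 = 0"
  "bk$1$1 = \<i>" "bk$1$2 = 0" "bk$2$1 = 0" "bk$2$2 = -\<i>"
  by (auto simp: bi_def bj_def bk_def)

lemma bounded_bilinear_mat2_mult: "bounded_bilinear ((**) :: mat2 \<Rightarrow> mat2 \<Rightarrow> mat2)"
  by (rule bilinear_conv_bounded_bilinear[THEN iffD1])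
     (auto simp: bilinear_def linear_iff mat2_eq algebra_simps)

lemma bounded_linear_adj: "bounded_linear adj"
  by (rule linear_conv_bounded_linear[THEN iffD1]) (auto simp: linear_iff mat2_eq)

lemma bounded_bilinear_ip: "bounded_bilinear ip"
  by (rule bilinear_conv_bounded_bilinear[THEN iffD1])
     (auto simp: bilinear_def linear_iff ip_def trace_mat2 algebra_simps add_divide_distrib diff_divide_distrib)

definition su2_proj :: "mat2 \<Rightarrow> mat2" where
  "su2_proj A = ip A bi *\<^sub>R bi + ip A bj *\<^sub>R bj + ip A bk *\<^sub>R bk"

lemma bounded_linear_su2_proj: "bounded_linear su2_proj"
  by (rule linear_conv_bounded_linear[THEN iffD1]) 
    (auto simp: linear_iff su2_proj_def ip_def trace_mat2 mat2_eq algebra_simps)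

lemma su2D: assumes "X \<in> su2" 
  shows "X$2$2 = - X$1$1" "Re (X$1$1) = 0" "X$2$1 = - cnj (X$1$2)"
proof -
  have a: "adj X = -X" "trace X = 0" using assms by (auto simp: su2_def)
  show "X$2$2 = - X$1$1" using a(2) by (simp add: trace_mat2 add_eq_0_iff)
  from a(1) have "cnj (X$1$1) = - X$1$1" "cnj (X$1$2) = - X$2$1" by (auto simp: mat2_eq)
  then show "Re (X$1$1) = 0" "X$2$1 = - cnj (X$1$2)" by (auto simp: complex_eq_iff)
qed

lemma su2_proj_eq: "X \<in> su2 \<Longrightarrow> su2_proj X = X"
  using su2D[of X] by (auto simp: su2_proj_def ip_def trace_mat2 mat2_eq complex_eq_iff field_simps)

lemma su2_proj_in: "su2_proj X \<in> su2"
  by (auto simp: su2_def su2_proj_def trace_mat2 mat2_eq complex_eq_iff)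

lemma ip_su2_proj: "Y \<in> su2 \<Longrightarrow> ip (su2_proj X) Y = ip X Y" "Y \<in> su2 \<Longrightarrow> ip Y (su2_proj X) = ip Y X"
  using su2D[of Y] by (auto simp: su2_proj_def ip_def trace_mat2 mat2_eq algebra_simps)

lemma SU2D: assumes "p \<in> SU2" shows "p ** adj p = mat 1" "adj p ** p = mat 1"
  using assms by (auto simp: SU2_def intro: matrix_left_right_inverse[THEN iffD1])

lemma tangentD: assumes "p \<in> SU2" "V \<in> tangent_space p" shows "adj p ** V \<in> su2"
  using assms SU2D[OF assms(1)] by (auto simp: tangent_space_def matrix_mul_assoc)

lemma adj_mult: "adj (A ** B) = adj B ** adj A"
  by (auto simp: mat2_eq algebra_simps)

definition lc_connection :: "(mat2 \<Rightarrow> mat2) \<Rightarrow> (mat2 \<Rightarrow> mat2) \<Rightarrow> mat2 \<Rightarrow> mat2" where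
  "lc_connection X Y p = p ** su2_proj (frechet_derivative (\<lambda>p. adj p ** Y p) (at p) (X p)
      + (1/2) *\<^sub>R ((adj p ** X p) ** (adj p ** Y p) - (adj p ** Y p) ** (adj p ** X p)))"

lemma C_k_adj: fixes X :: "mat2 \<Rightarrow> mat2" shows "C_k n X \<Longrightarrow> C_k n (\<lambda>p. adj p ** X p)"
  by (rule C_k_bilinear[OF bounded_bilinear_mat2_mult C_k_linear[OF bounded_linear_adj]])

lemma smooth_lc: assumes "smooth X" "smooth Y" shows "smooth (lc_connection X Y)"
proof -
  have "C_k n (lc_connection X Y)" for n
  proof -
    have a: "C_k n (\<lambda>p. adj p ** X p)" "C_k n (\<lambda>p. adj p ** Y p)" "C_k (Suc n) (\<lambda>p. adj p ** Y p)" "C_k n X"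
      using assms by (simp_all only: smooth_def C_k_adj)
    have d: "C_k n (\<lambda>p. frechet_derivative (\<lambda>p. adj p ** Y p) (at p) (X p))"
      by (rule C_k_directional[OF a(3,4)])
    have b: "C_k n (\<lambda>p. (-1) *\<^sub>R ((adj p ** Y p) ** (adj p ** X p)))"
      by (rule C_k_compose_linear[OF bounded_linear_scaleR_right C_k_bilinear[OF bounded_bilinear_mat2_mult a(2) a(1)]])
    note c = C_k_add[OF C_k_bilinear[OF bounded_bilinear_mat2_mult a(1) a(2)] b]
    note e = C_k_compose_linear[OF bounded_linear_su2_proj C_k_add[OF d C_k_compose_linear[OF bounded_linear_scaleR_right c, of "1/2"]]]
    from C_k_bilinear[OF bounded_bilinear_mat2_mult C_k_linear[OF bounded_linear_ident] e]
    show ?thesis unfolding lc_connection_def[abs_def] by simp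
  qed
  then show ?thesis unfolding smooth_def by simp
qed

lemma vf_lc: "vector_field X \<Longrightarrow> vector_field Y \<Longrightarrow> vector_field (lc_connection X Y)"
proof -
  assume "vector_field X" "vector_field Y"
  then have "smooth (lc_connection X Y)" by (simp add: vector_field_def smooth_lc)
  moreover have "lc_connection X Y p \<in> tangent_space p" for p
    unfolding tangent_space_def lc_connection_def using su2_proj_in by blast
  ultimately show ?thesis by (simp add: vector_field_def)
qed

lemma deriv_left: fixes Y :: "mat2 \<Rightarrow> mat2" assumes "smooth Y"
  shows "((\<lambda>p. adj p ** Y p) has_derivative 
     (\<lambda>v. adj p ** frechet_derivative Y (at p) v + adj v ** Y p)) (at p)"
  by (rule bounded_bilinear.FDERIV[OF bounded_bilinear_mat2_mult bounded_linear_imp_has_derivative[OF bounded_linear_adj]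
        frechet_derivative_worksI[OF smooth_differentiable[OF assms]]])

lemma deriv_left_eq: fixes Y :: "mat2 \<Rightarrow> mat2" assumes "smooth Y"
  shows "frechet_derivative (\<lambda>p. adj p ** Y p) (at p) =
     (\<lambda>v. adj p ** frechet_derivative Y (at p) v + adj v ** Y p)"
  by (rule frechet_derivative_at[OF deriv_left[OF assms], symmetric])

lemma SU2_curve:
  assumes A: "A \<in> su2" and p: "p \<in> SU2" 
  obtains c :: "real \<Rightarrow> mat2" where "\<And>t. c t \<in> SU2" "c 0 = p" "(c has_vector_derivative (p ** A)) (at 0)"
proof (cases "A = 0")
  case True
  have "p ** A = 0" using True by (simp add: mat2_eq)
  then show ?thesis using p that[of "\<lambda>t. p"] by simp
next
  case False
  define r where "r = sqrt ((cmod (A$1$1))\<^sup>2 + (cmod (A$1$2))\<^sup>2)"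
  have rpos: "r > 0" using False su2D[OF A] unfolding r_def 
    by (auto simp: mat2_eq add_nonneg_pos add_pos_nonneg)
  have r2: "r\<^sup>2 = (cmod (A$1$1))\<^sup>2 + (cmod (A$1$2))\<^sup>2" unfolding r_def by simp
  define C :: "real \<Rightarrow> mat2" where "C t = cos (r * t) *\<^sub>R mat 1 + (sin (r*t) / r) *\<^sub>R A" for t
  have C1: "C t ** adj (C t) = mat 1 \<and> det (C t) = 1" for t
  proof -
    define u where "u = cos (r*t)" define w where "w = sin (r*t) / r"
    have C': "C t = u *\<^sub>R mat 1 + w *\<^sub>R A" unfolding C_def u_def w_def ..
    have "u\<^sup>2 + w\<^sup>2 * r\<^sup>2 = 1" using rpos unfolding u_def w_def by (simp add: field_simps)
    then have e: "u\<^sup>2 + w\<^sup>2 * ((Im (A$1$1))\<^sup>2 + (Re (A$1$2))\<^sup>2 + (Im (A$1$2))\<^sup>2) = 1"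
      using r2 su2D[OF A] by (simp add: cmod_power2 add.assoc)
    show ?thesis unfolding C' det_2 using su2D[OF A] e
      by (auto simp: mat2_eq complex_eq_iff power2_eq_square algebra_simps)
  qed
  have "p ** C t \<in> SU2" for t
  proof -
    have "(p ** C t) ** adj (p ** C t) = p ** (C t ** adj (C t)) ** adj p"
      by (simp add: adj_mult matrix_mul_assoc)
    then show ?thesis using C1[of t] p by (auto simp: SU2_def det_mul)
  qed
  moreover have "p ** C 0 = p" by (simp add: C_def)
  moreover have "(C has_vector_derivative A) (at 0)"
  proof -
    have "((\<lambda>t. cos (r * t)) has_real_derivative 0) (at 0)" "((\<lambda>t. sin (r*t) / r) has_real_derivative 1) (at 0)"
      using rpos by (auto intro!: derivative_eq_intros)
    from has_vector_derivative_add[OF this[THEN has_vector_derivative_scaleR, OF has_vector_derivative_const], of "mat 1" A]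
    show ?thesis unfolding C_def[abs_def] by simp
  qed
  then have "((\<lambda>t. p ** C t) has_vector_derivative (p ** A)) (at 0)"
    by (rule bounded_linear.has_vector_derivative[OF bounded_bilinear.bounded_linear_right[OF bounded_bilinear_mat2_mult]])
  ultimately show ?thesis by (rule that[of "\<lambda>t. p ** C t"])
qed

lemma deriv_left_su2:
  assumes Y: "vector_field Y" and p: "p \<in> SU2" and V: "V \<in> tangent_space p"
  shows "frechet_derivative (\<lambda>p. adj p ** Y p) (at p) V \<in> su2" (is "?D V \<in> _")
proof -
  obtain A where A: "A \<in> su2" "V = p ** A" using V by (auto simp: tangent_space_def)
  obtain c where c: "\<And>t. c t \<in> SU2" "c 0 = p" "(c has_vector_derivative V) (at 0)"
    unfolding A(2) by (rule SU2_curve[OF A(1) p]) blast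
  let ?y = "\<lambda>p. adj p ** Y p"
  have s: "smooth Y" using Y by (simp add: vector_field_def)
  have "(?y has_derivative ?D) (at (c 0))" unfolding c(2)
    using deriv_left[OF s] by (simp only: deriv_left_eq[OF s])
  from diff_chain_at[OF c(3)[unfolded has_vector_derivative_def] this]
  have d: "((\<lambda>t. ?y (c t)) has_derivative (\<lambda>h. ?D (h *\<^sub>R V))) (at 0)" by (simp add: o_def)
  have y: "?y (c t) \<in> su2" for t
    by (rule tangentD[OF c(1)]) (use Y c(1) in \<open>simp add: vector_field_def\<close>)
  have "((\<lambda>t. su2_proj (?y (c t))) has_derivative (\<lambda>h. su2_proj (?D (h *\<^sub>R V)))) (at 0)"
    by (rule bounded_linear.has_derivative[OF bounded_linear_su2_proj d])
  then have "((\<lambda>t. ?y (c t)) has_derivative (\<lambda>h. su2_proj (?D (h *\<^sub>R V)))) (at 0)"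
    using y by (simp add: su2_proj_eq)
  from has_derivative_unique[OF this d] have "(\<lambda>h. su2_proj (?D (h *\<^sub>R V))) = (\<lambda>h. ?D (h *\<^sub>R V))" .
  from fun_cong[OF this, of 1] have "su2_proj (?D V) = ?D V" by simp
  then show ?thesis using su2_proj_in[of "?D V"] by simp
qed

lemma lc_connection_torsion:
  assumes X: "vector_field X" and Y: "vector_field Y" and p: "p \<in> SU2" 
  shows "lc_connection X Y p - lc_connection Y X p = lie_bracket X Y p"
proof -
  have s: "smooth X" "smooth Y" and t: "X p \<in> tangent_space p" "Y p \<in> tangent_space p"
    using X Y p by (auto simp: vector_field_def)
  obtain x y where x: "x \<in> su2" "X p = p ** x" and y: "y \<in> su2" "Y p = p ** y"
    using t by (auto simp: tangent_space_def)
  have i: "adj p ** (p ** Z) = Z" "p ** (adj p ** Z) = Z" for Z :: mat2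
    using SU2D[OF p] by (auto simp: matrix_mul_assoc)
  let ?dy = "frechet_derivative (\<lambda>p. adj p ** Y p) (at p) (X p)"
  let ?dx = "frechet_derivative (\<lambda>p. adj p ** X p) (at p) (Y p)"
  let ?DY = "frechet_derivative Y (at p) (X p)"
  let ?DX = "frechet_derivative X (at p) (Y p)"
  have ax: "adj (X p) = - x ** adj p" "adj (Y p) = - y ** adj p" 
    using x y by (auto simp: adj_mult su2_def)
  have neg: "(- A) ** B = - (A ** B)" "A ** (- B) = - (A ** B)" for A B :: mat2
    by (auto simp: mat2_eq)
  have dy: "?dy = adj p ** ?DY - x ** y" unfolding deriv_left_eq[OF s(2)] ax(1) y(2)
    by (simp add: matrix_mul_assoc[symmetric] i neg)
  have dx: "?dx = adj p ** ?DX - y ** x" unfolding deriv_left_eq[OF s(1)] ax(2) x(2)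
    by (simp add: matrix_mul_assoc[symmetric] i neg)
  have "x ** y - y ** x \<in> su2" using su2D[OF x(1)] su2D[OF y(1)]
    by (auto simp: su2_def mat2_eq trace_mat2 complex_eq_iff algebra_simps)
  then have br: "su2_proj (x ** y - y ** x) = x ** y - y ** x" by (rule su2_proj_eq)
  have p1: "su2_proj ?dy = ?dy" "su2_proj ?dx = ?dx" 
    using deriv_left_su2[OF Y p t(1)] deriv_left_su2[OF X p t(2)] by (simp_all add: su2_proj_eq)
  interpret P: bounded_linear su2_proj by (rule bounded_linear_su2_proj)
  interpret M: bounded_bilinear "(**) :: mat2 \<Rightarrow> mat2 \<Rightarrow> mat2" by (rule bounded_bilinear_mat2_mult)
  have "lc_connection X Y p - lc_connection Y X p = p ** (?dy - ?dx + (x ** y - y ** x))"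
  proof -
    have e: "lc_connection X Y p = p ** (?dy + (1/2) *\<^sub>R (x ** y - y ** x))"
      unfolding lc_connection_def P.add P.scaleR x(2) y(2) i br by (simp add: p1(1)[unfolded x(2)])
    have "su2_proj (y ** x - x ** y) = y ** x - x ** y" 
      using br linear_neg[OF bounded_linear.linear[OF bounded_linear_su2_proj], of "x ** y - y ** x"] by simp
    then have e': "lc_connection Y X p = p ** (?dx + (1/2) *\<^sub>R (y ** x - x ** y))"
      unfolding lc_connection_def P.add P.scaleR x(2) y(2) i by (simp add: p1(2)[unfolded y(2)])
    have h: "(1/2) *\<^sub>R a - (1/2) *\<^sub>R b = a" if "b = - a" for a b :: mat2
      using that by (simp add: scaleR_left_distrib[symmetric])
    show ?thesis unfolding e e' M.diff_right[symmetric]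
      by (rule arg_cong[of _ _ "(**) p"], subst (3) h[symmetric, of "y ** x - x ** y"]) auto
  qed
  also have "\<dots> = p ** (adj p ** (?DY - ?DX))" unfolding dy dx by (simp add: M.diff_right)
  also have "\<dots> = lie_bracket X Y p" unfolding i lie_bracket_def field_deriv_def ..
  finally show ?thesis .
qed

lemma lc_connection_metric:
  assumes X: "vector_field X" and Y: "vector_field Y" and Z: "vector_field Z" and p: "p \<in> SU2"
  shows "field_deriv X (\<lambda>p. gmetric p (Y p) (Z p)) p =
           gmetric p (lc_connection X Y p) (Z p) + gmetric p (Y p) (lc_connection X Z p)"
proof -
  have s: "smooth Y" "smooth Z" using Y Z by (auto simp: vector_field_def)
  define x y z where "x = adj p ** X p" "y = adj p ** Y p" "z = adj p ** Z p"
  have m: "x \<in> su2" "y \<in> su2" "z \<in> su2"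
    unfolding x_y_z_def using X Y Z p tangentD[OF p] by (simp_all add: vector_field_def)
  let ?dy = "frechet_derivative (\<lambda>p. adj p ** Y p) (at p)"
  let ?dz = "frechet_derivative (\<lambda>p. adj p ** Z p) (at p)"
  have "((\<lambda>p. adj p ** Y p) has_derivative ?dy) (at p)" "((\<lambda>p. adj p ** Z p) has_derivative ?dz) (at p)"
    using deriv_left[OF s(1), of p] deriv_left[OF s(2), of p]
    by (simp_all only: deriv_left_eq[OF s(1)] deriv_left_eq[OF s(2)])
  then have "((\<lambda>p. gmetric p (Y p) (Z p)) has_derivative (\<lambda>v. ip y (?dz v) + ip (?dy v) z)) (at p)"
    unfolding gmetric_def x_y_z_def by (rule bounded_bilinear.FDERIV[OF bounded_bilinear_ip])
  note h = this
  have "field_deriv X (\<lambda>p. gmetric p (Y p) (Z p)) p = ip y (?dz (X p)) + ip (?dy (X p)) z"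
    unfolding field_deriv_def frechet_derivative_at[OF h, symmetric] ..
  moreover have i: "adj p ** (p ** W) = W" for W :: mat2
    using SU2D[OF p] by (auto simp: matrix_mul_assoc)
  have "gmetric p (lc_connection X Y p) (Z p) = ip (?dy (X p) + (1/2) *\<^sub>R (x ** y - y ** x)) z"
    unfolding gmetric_def lc_connection_def i x_y_z_def[symmetric] using ip_su2_proj m by simp
  moreover have "gmetric p (Y p) (lc_connection X Z p) = ip y (?dz (X p) + (1/2) *\<^sub>R (x ** z - z ** x))"
    unfolding gmetric_def lc_connection_def i x_y_z_def[symmetric] using ip_su2_proj m by simp
  moreover have "ip ((1/2) *\<^sub>R (x ** y - y ** x)) z + ip y ((1/2) *\<^sub>R (x ** z - z ** x)) = 0"
  proof -
    interpret M: bounded_bilinear "(**) :: mat2 \<Rightarrow> mat2 \<Rightarrow> mat2" by (rule bounded_bilinear_mat2_mult)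
    interpret I: bounded_bilinear ip by (rule bounded_bilinear_ip)
    have "trace (y ** (z ** x)) = trace (x ** (y ** z))"
      using trace_mul_sym[of "y ** z" x] by (simp add: matrix_mul_assoc)
    then have "ip (x ** y - y ** x) z + ip y (x ** z - z ** x) = 0"
      unfolding I.diff_left I.diff_right by (simp add: ip_def matrix_mul_assoc)
    then show ?thesis unfolding I.scaleR_left I.scaleR_right by (simp flip: distrib_left add_divide_distrib)
  qed
  ultimately show ?thesis
    by (simp add: bounded_bilinear.add_left[OF bounded_bilinear_ip] bounded_bilinear.add_right[OF bounded_bilinear_ip])
qed

lemma lc_connection_affine: "affine_connection lc_connection"
proof -
  interpret P: bounded_linear su2_proj by (rule bounded_linear_su2_proj)
  interpret M: bounded_bilinear "(**) :: mat2 \<Rightarrow> mat2 \<Rightarrow> mat2" by (rule bounded_bilinear_mat2_mult)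
  have lin: "linear (frechet_derivative (\<lambda>p. adj p ** Y p) (at p))" if "vector_field Y" for Y p
  proof -
    have "smooth Y" using that by (simp add: vector_field_def)
    then show ?thesis using deriv_left[of Y p] by (intro linear_frechet_derivative) (auto simp: differentiable_def)
  qed
  note S = P.add P.diff P.scaleR M.add_left M.add_right M.diff_left M.diff_right M.scaleR_left M.scaleR_right
  have 1: "lc_connection (\<lambda>p. X p + X' p) Y p = lc_connection X Y p + lc_connection X' Y p" if "vector_field Y" for X X' Y p
    unfolding lc_connection_def linear_add[OF lin[OF that]] by (simp add: S algebra_simps)
  have 2: "lc_connection (\<lambda>p. f p *\<^sub>R X p) Y p = f p *\<^sub>R lc_connection X Y p" if "vector_field Y" for f X Y p
    unfolding lc_connection_def linear_cmul[OF lin[OF that]] by (simp add: S algebra_simps)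
  have 3: "lc_connection X (\<lambda>p. Y p + Y' p) p = lc_connection X Y p + lc_connection X Y' p" if "vector_field Y" "vector_field Y'" for X Y Y' p
  proof -
    have "smooth Y" "smooth Y'" using that by (auto simp: vector_field_def)
    then have "((\<lambda>p. adj p ** Y p + adj p ** Y' p) has_derivative (\<lambda>v. 
       frechet_derivative (\<lambda>p. adj p ** Y p) (at p) v + frechet_derivative (\<lambda>p. adj p ** Y' p) (at p) v)) (at p)"
      by (intro has_derivative_add) (simp_all only: deriv_left_eq deriv_left)
    note h = this
    have e: "frechet_derivative (\<lambda>p. adj p ** (Y p + Y' p)) (at p) = (\<lambda>v. 
       frechet_derivative (\<lambda>p. adj p ** Y p) (at p) v + frechet_derivative (\<lambda>p. adj p ** Y' p) (at p) v)"
      unfolding M.add_right by (rule frechet_derivative_at[OF h, symmetric])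
    show ?thesis unfolding lc_connection_def e 
      by (simp add: S algebra_simps)
  qed
  have 4: "lc_connection X (\<lambda>p. f p *\<^sub>R Y p) p = field_deriv X f p *\<^sub>R Y p + f p *\<^sub>R lc_connection X Y p"
    if "smooth f" "vector_field Y" "p \<in> SU2" for f X Y p
  proof -
    have s: "smooth Y" and t: "adj p ** Y p \<in> su2" using that tangentD by (auto simp: vector_field_def)
    have "((\<lambda>p. f p *\<^sub>R (adj p ** Y p)) has_derivative (\<lambda>v. 
       f p *\<^sub>R frechet_derivative (\<lambda>p. adj p ** Y p) (at p) v + frechet_derivative f (at p) v *\<^sub>R (adj p ** Y p))) (at p)"
      unfolding deriv_left_eq[OF s]
      by (rule bounded_bilinear.FDERIV[OF bounded_bilinear_scaleR frechet_derivative_worksI[OF smooth_differentiable[OF that(1)]] deriv_left[OF s]])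
    note h = this
    have e: "frechet_derivative (\<lambda>p. adj p ** (f p *\<^sub>R Y p)) (at p) = (\<lambda>v. 
       f p *\<^sub>R frechet_derivative (\<lambda>p. adj p ** Y p) (at p) v + frechet_derivative f (at p) v *\<^sub>R (adj p ** Y p))"
      unfolding M.scaleR_right by (rule frechet_derivative_at[OF h, symmetric])
    have i: "p ** (adj p ** W) = W" for W :: mat2
      using SU2D[OF that(3)] by (auto simp: matrix_mul_assoc)
    show ?thesis unfolding lc_connection_def e field_deriv_def
      by (simp add: S su2_proj_eq[OF t] i algebra_simps)
  qed
  show ?thesis unfolding affine_connection_def using vf_lc 1 2 3 4 by (intro conjI allI impI ballI) simp_all
qed

theorem levi_civita_exists: "\<exists>nabla. levi_civita nabla"
  unfolding levi_civita_def using lc_connection_affine lc_connection_torsion lc_connection_metric by blast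

declare mat2_mult_nth [simp del] adj_nth [simp del] mat2_one_nth [simp del] basis_nth [simp del]

end

theory Submission
  imports Defs
begin

text \<open>Left translation turns the velocity of a magnetic curve \<open>c\<close> into the curve
  \<open>x = c\<^sup>* c'\<close> in the Lie algebra. The metric is bi-invariant, so \<open>\<nabla>\<^bsub>X\<^esub> Y = [X, Y] / 2\<close> for
  left-invariant fields, the connection term of the covariant derivative of the velocity is
  \<open>[x, x] / 2 = 0\<close>, and the magnetic equation reduces to the linear equation
  \<open>x' = q (x\<^sub>2 i - x\<^sub>1 j) = (q / 2) [x, k]\<close>. With \<open>v = (q / 2) k\<close> its solution is
  \<open>x(s) = exp(- s v) x(0) exp(s v)\<close>, a rotation about the \<open>k\<close>-axis. In the frame that rotates
  along, the equation \<open>c' = c x\<close> has the constant coefficient \<open>u = x(0) - v\<close>, and hence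
  \<open>c(s) = c(0) exp(s u) exp(s v)\<close> (\<open>magnetic_curve_explicit\<close>).

  The two factors have angular speeds \<open>\<bar>v\<bar> = \<bar>q\<bar> / 2\<close> and
  \<open>\<bar>u\<bar> = sqrt (1 - q cos \<theta> + q\<^sup>2 / 4)\<close>, so that \<open>\<bar>v\<bar> / \<bar>u\<bar>\<close> is the absolute value of
  \<open>q / sqrt (q\<^sup>2 - 4 q cos \<theta> + 4)\<close>. If this is rational, the factors have a common period.
  Conversely \<open>c(l) = c(0)\<close> means \<open>exp(l u) = exp(- l v)\<close>. When \<open>u\<close> and \<open>v\<close> are linearly
  independent, the one-parameter groups that they generate meet only in \<open>\<plusminus> 1\<close>, so
  \<open>l \<bar>u\<bar>\<close> and \<open>l \<bar>v\<bar>\<close> are integer multiples of \<open>\<pi>\<close>. Independence is exactly the condition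
  \<open>sin \<theta> \<noteq> 0\<close>. For \<open>sin \<theta> = 0\<close> the vectors \<open>u\<close> and \<open>v\<close> are parallel, and the curve is a great
  circle, which is periodic for every \<open>q\<close>; this is why only one implication is claimed
  then. In the extreme case \<open>u = 0\<close> the quotient is \<open>q / 0 = 0\<close> by convention, and the curve is
  indeed periodic.\<close>

section \<open>Matrix algebra\<close>

interpretation mat2_mult: bounded_bilinear "(**) :: mat2 \<Rightarrow> mat2 \<Rightarrow> mat2"
  by (rule bounded_bilinear_mat2_mult)

interpretation ip: bounded_bilinear ip
  by (rule bounded_bilinear_ip)

lemmas mat2_simps = mat2_eq mat2_mult_nth adj_nth mat2_one_nth basis_nth trace_mat2

lemma basis_in_su2: "bi \<in> su2" "bj \<in> su2" "bk \<in> su2"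
  by (auto simp: su2_def mat2_simps)

lemma su2_add: "X \<in> su2 \<Longrightarrow> Y \<in> su2 \<Longrightarrow> X + Y \<in> su2"
  by (auto simp: su2_def mat2_simps add_eq_0_iff)

lemma su2_scaleR: "X \<in> su2 \<Longrightarrow> a *\<^sub>R X \<in> su2"
  by (auto simp: su2_def mat2_simps simp flip: scaleR_add_right)

lemma su2_diff: "X \<in> su2 \<Longrightarrow> Y \<in> su2 \<Longrightarrow> X - Y \<in> su2"
  using su2_add[of X "(-1) *\<^sub>R Y"] su2_scaleR[of Y "-1"] by simp

lemma ip_commute: "ip X Y = ip Y X"
  by (simp add: ip_def trace_mul_sym[of X Y])

lemma ip_bk_bk: "ip bk bk = 1"
  by (simp add: ip_def mat2_simps)

lemma ip_pos:
  assumes "X \<in> su2" shows "ip X X \<ge> 0" "ip X X = 0 \<longleftrightarrow> X = 0"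
proof -
  have e: "ip X X = (Im (X$1$1))\<^sup>2 + (Re (X$1$2))\<^sup>2 + (Im (X$1$2))\<^sup>2"
    using su2D[OF assms] by (simp add: ip_def mat2_simps power2_eq_square field_simps)
  show "ip X X \<ge> 0" unfolding e by simp
  have "ip X X = 0 \<longleftrightarrow> Im (X$1$1) = 0 \<and> Re (X$1$2) = 0 \<and> Im (X$1$2) = 0"
    unfolding e by (simp add: add_nonneg_eq_0_iff)
  then show "ip X X = 0 \<longleftrightarrow> X = 0"
    using su2D[OF assms] by (auto simp: mat2_simps complex_eq_iff)
qed

text \<open>A nonzero \<open>X\<close> divided by its norm squares to minus the identity, like an imaginary unit; this
  is why the exponential series of \<open>t X\<close> sums to a cosine and a sine.\<close>

lemma su2_square: "X \<in> su2 \<Longrightarrow> X ** X = (- ip X X) *\<^sub>R mat 1"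
  using su2D[of X] by (auto simp: ip_def mat2_simps complex_eq_iff algebra_simps)

lemma SU2_cancel:
  fixes X Y :: mat2
  assumes "p \<in> SU2"
  shows "adj p ** (p ** X) = X" "p ** (adj p ** X) = X" "p ** X = p ** Y \<longleftrightarrow> X = Y"
proof -
  show 1: "adj p ** (p ** X) = X" for X :: mat2
    using SU2D[OF assms] by (simp add: matrix_mul_assoc)
  show "p ** (adj p ** X) = X" using SU2D[OF assms] by (simp add: matrix_mul_assoc)
  show "p ** X = p ** Y \<longleftrightarrow> X = Y" using 1 by metis
qed

section \<open>The Levi-Civita connection on left-invariant fields\<close>

lemma vector_field_left_invariant:
  assumes "X \<in> su2" shows "vector_field (left_invariant_field X)"
proof -
  have "bounded_linear (\<lambda>p::mat2. p ** X)" by (rule mat2_mult.bounded_linear_left)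
  then show ?thesis using assms
    by (auto simp: vector_field_def smooth_def tangent_space_def left_invariant_field_def[abs_def] C_k_linear)
qed

text \<open>Uniqueness of the Levi-Civita connection, which makes the explicit connection
  \<^const>\<open>lc_connection\<close> available for computing with any other one. The difference \<open>D\<close> of two
  torsion-free metric connections is symmetric in its two arguments by torsion, and
  \<open>ip (D X Y) Z\<close> is skew in \<open>Y\<close> and \<open>Z\<close> by compatibility with the metric.\<close>

lemma levi_civita_eq_lc:
  assumes n: "levi_civita nabla" and X: "vector_field X" and Y: "vector_field Y" and p: "p \<in> SU2"
  shows "nabla X Y p = lc_connection X Y p"
proof -
  have nabla:
    "\<forall>X Y. vector_field X \<longrightarrow> vector_field Y \<longrightarrow> vector_field (nabla X Y)"
    "\<forall>X Y. vector_field X \<longrightarrow> vector_field Y \<longrightarrow>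
        (\<forall>p\<in>SU2. nabla X Y p - nabla Y X p = lie_bracket X Y p)"
    "\<forall>X Y Z. vector_field X \<longrightarrow> vector_field Y \<longrightarrow> vector_field Z \<longrightarrow>
        (\<forall>p\<in>SU2. field_deriv X (\<lambda>p. gmetric p (Y p) (Z p)) p =
           gmetric p (nabla X Y p) (Z p) + gmetric p (Y p) (nabla X Z p))"
    using n unfolding levi_civita_def affine_connection_def by - (elim conjE, assumption)+
  define D where "D X Y = adj p ** (nabla X Y p - lc_connection X Y p)" for X Y
  have tan: "D X Y \<in> su2" if "vector_field X" "vector_field Y" for X Y :: "mat2 \<Rightarrow> mat2"
  proof -
    have "vector_field (nabla X Y)" using nabla(1) that by simp
    then show ?thesis using that vf_lc[OF that] tangentD[OF p] p
      by (simp add: D_def mat2_mult.diff_right su2_diff vector_field_def)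
  qed
  have sym: "D X Y = D Y X" if "vector_field X" "vector_field Y" for X Y
  proof -
    have "nabla X Y p - nabla Y X p = lie_bracket X Y p"
      using nabla(2) that p by simp
    with lc_connection_torsion[OF that p]
    have "nabla X Y p - lc_connection X Y p = nabla Y X p - lc_connection Y X p"
      by (simp add: algebra_simps)
    then show ?thesis by (simp add: D_def)
  qed
  have skew: "ip (D X Y) (adj p ** Z p) = - ip (D X Z) (adj p ** Y p)"
    if "vector_field X" "vector_field Y" "vector_field Z" for X Y Z
  proof -
    have "gmetric p (nabla X Y p) (Z p) + gmetric p (Y p) (nabla X Z p) =
      gmetric p (lc_connection X Y p) (Z p) + gmetric p (Y p) (lc_connection X Z p)"
      using nabla(3) that p lc_connection_metric[OF that p] by simp
    then show ?thesis
      by (simp add: gmetric_def D_def mat2_mult.diff_right ip.diff_left ip_commute[of "adj p ** Y p"])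
  qed
  define Z where "Z = left_invariant_field (D X Y)"
  have Z: "vector_field Z" unfolding Z_def by (rule vector_field_left_invariant[OF tan[OF X Y]])
  \<comment> \<open>A trilinear form that is symmetric in one pair of slots and skew in another vanishes.\<close>
  have "ip (D X Y) (adj p ** Z p) = 0"
    using skew[OF X Y Z] skew[OF Z X Y] skew[OF Y Z X] sym[OF X Y] sym[OF Y Z] sym[OF Z X] by simp
  then have "ip (D X Y) (D X Y) = 0"
    by (simp add: Z_def left_invariant_field_def SU2_cancel[OF p])
  then have "D X Y = 0" using ip_pos(2)[OF tan[OF X Y]] by simp
  then have "p ** D X Y = 0" by simp
  then show ?thesis by (simp add: D_def SU2_cancel[OF p])
qed

text \<open>Left-invariant fields have constant coefficients in the left trivialization, so only the
  bracket term of the explicit connection remains.\<close>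

lemma levi_civita_left_invariant:
  assumes n: "levi_civita nabla" and X: "X \<in> su2" and Y: "Y \<in> su2" and p: "p \<in> SU2"
  shows "nabla (left_invariant_field X) (left_invariant_field Y) p =
    p ** ((1/2) *\<^sub>R (X ** Y - Y ** X))"
proof -
  have s: "smooth (left_invariant_field Y)"
    using vector_field_left_invariant[OF Y] by (simp add: vector_field_def)
  have "(left_invariant_field Y has_derivative (\<lambda>V. V ** Y)) (at p)"
    unfolding left_invariant_field_def[abs_def]
    by (rule bounded_linear_imp_has_derivative[OF mat2_mult.bounded_linear_left])
  then have d: "frechet_derivative (left_invariant_field Y) (at p) = (\<lambda>V. V ** Y)"
    by (metis frechet_derivative_at)
  \<comment> \<open>Off the group, \<open>adj p ** (p ** Y)\<close> is not constant; that \<open>X\<close> is skew-Hermitian makes its derivative vanish in the tangent direction \<open>p ** X\<close>.\<close>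
  have 0: "frechet_derivative (\<lambda>p. adj p ** left_invariant_field Y p) (at p) (p ** X) = 0"
  proof -
    have "adj p ** ((p ** X) ** Y) + adj (p ** X) ** (p ** Y) = X ** Y + adj X ** Y"
      by (simp add: adj_mult SU2_cancel[OF p] flip: matrix_mul_assoc)
    also have "\<dots> = 0" using X by (simp add: su2_def mat2_mult.minus_left)
    finally show ?thesis unfolding deriv_left_eq[OF s] d by (simp add: left_invariant_field_def)
  qed
  have "(1/2) *\<^sub>R (X ** Y - Y ** X) \<in> su2" using su2D[OF X] su2D[OF Y]
    by (auto simp: su2_def mat2_simps complex_eq_iff algebra_simps)
  then show ?thesis
    using 0 levi_civita_eq_lc[OF n vector_field_left_invariant[OF X] vector_field_left_invariant[OF Y] p]
    by (simp add: lc_connection_def left_invariant_field_def SU2_cancel[OF p] su2_proj_eq)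
qed

section \<open>One-parameter subgroups\<close>

text \<open>For \<open>X\<close> in the Lie algebra this is the matrix exponential of \<open>t X\<close>. It gives the identity
  for \<open>X = 0\<close>, because the sine term vanishes with \<open>X\<close>.\<close>

definition one_param :: "mat2 \<Rightarrow> real \<Rightarrow> mat2" where
  "one_param X t = cos (sqrt (ip X X) * t) *\<^sub>R mat 1 + (sin (sqrt (ip X X) * t) / sqrt (ip X X)) *\<^sub>R X"

lemma one_param_0: "one_param X 0 = mat 1"
  by (simp add: one_param_def)

lemma one_param_commute: "X ** one_param X t = one_param X t ** X"
  by (simp add: one_param_def mat2_mult.add_left mat2_mult.add_right
      mat2_mult.scaleR_left mat2_mult.scaleR_right)

lemma one_param_has_derivative:
  assumes X: "X \<in> su2"
  shows "(one_param X has_vector_derivative one_param X t ** X) (at t)"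
proof (cases "X = 0")
  case True
  then show ?thesis by (simp add: one_param_def[abs_def] ip.zero_left)
next
  case False
  define r where "r = sqrt (ip X X)"
  have r: "r > 0" "ip X X = r * r" using False ip_pos[OF X] by (auto simp: r_def order_less_le)
  have "((\<lambda>t. cos (r * t)) has_real_derivative (- r * sin (r * t))) (at t)"
    "((\<lambda>t. sin (r * t) / r) has_real_derivative cos (r * t)) (at t)"
    using r(1) by (auto intro!: derivative_eq_intros)
  from has_vector_derivative_add[OF this[THEN has_vector_derivative_scaleR, OF has_vector_derivative_const], of "mat 1" X]
  have "(one_param X has_vector_derivative (- r * sin (r * t)) *\<^sub>R mat 1 + cos (r * t) *\<^sub>R X) (at t)"
    by (simp add: one_param_def[abs_def] flip: r_def)
  also have "(- r * sin (r * t)) *\<^sub>R mat 1 + cos (r * t) *\<^sub>R X = one_param X t ** X"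
    using r by (simp add: one_param_def mat2_mult.add_left mat2_mult.scaleR_left su2_square[OF X] flip: r_def)
  finally show ?thesis .
qed

lemma one_param_inverse:
  assumes X: "X \<in> su2"
  shows "one_param X t ** one_param X (- t) = mat 1"
proof (cases "X = 0")
  case True
  then show ?thesis by (simp add: one_param_def ip.zero_left)
next
  case False
  define r where "r = sqrt (ip X X)"
  have r: "r > 0" "ip X X = r * r" using False ip_pos[OF X] by (auto simp: r_def order_less_le)
  have "one_param X t ** one_param X (- t) = (cos (r * t))\<^sup>2 *\<^sub>R mat 1 + (sin (r * t))\<^sup>2 *\<^sub>R mat 1"
    using r(1) by (simp add: one_param_def mat2_mult.add_left mat2_mult.add_right mat2_mult.scaleR_left
      mat2_mult.scaleR_right mat2_mult.diff_right scaleR_diff_right su2_square[OF X] r(2) scaleR_add_right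
      power2_eq_square mult.commute flip: r_def)
  then show ?thesis by (simp flip: scaleR_add_left)
qed

lemma one_param_neg_has_derivative:
  assumes "X \<in> su2"
  shows "((\<lambda>t. one_param X (- t)) has_vector_derivative - (one_param X (- t) ** X)) (at t)"
proof -
  have "(uminus has_vector_derivative -1) (at t)" for t :: real
    by (auto intro!: derivative_eq_intros)
  from vector_diff_chain_at[OF this one_param_has_derivative[OF assms]]
  show ?thesis by (simp add: o_def)
qed

lemma one_param_periodic:
  assumes "sqrt (ip X X) * l = 2 * pi * of_int n"
  shows "one_param X (t + l) = one_param X t"
  using assms by (simp add: one_param_def distrib_left sin_add cos_add)

text \<open>With \<open>\<bar>v\<bar> / \<bar>u\<bar> = m / n\<close> the number \<open>2 \<pi> n / \<bar>u\<bar>\<close> is a common period of both factors. The case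
  \<open>u = 0\<close>, where the quotient is \<open>0\<close> by convention, is covered by the period \<open>2 \<pi> / \<bar>v\<bar>\<close> of the
  second factor.\<close>

lemma periodic_product_if:
  assumes u: "u \<in> su2" and v: "v \<in> su2" and "v \<noteq> 0" and "sqrt (ip v v) / sqrt (ip u u) \<in> \<rat>"
  shows "periodic (\<lambda>s. one_param u s ** one_param v s)"
proof -
  define a b where "a = sqrt (ip u u)" "b = sqrt (ip v v)"
  have pos: "a \<ge> 0" "b > 0" using ip_pos[OF u] ip_pos[OF v] \<open>v \<noteq> 0\<close>
    by (auto simp: a_b_def order_less_le)
  have "\<exists>l>0. \<exists>m n. a * l = 2 * pi * of_int m \<and> b * l = 2 * pi * of_int n"
  proof (cases "a = 0")
    case True
    have "2 * pi / b > 0" "b * (2 * pi / b) = 2 * pi * of_int 1" using pos by auto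
    then show ?thesis using True by (metis mult_zero_left mult_zero_right of_int_0)
  next
    case False
    obtain m n where mn: "b / a = of_int m / of_int n" "n > 0"
      using assms(4) unfolding a_b_def by (elim Rats_cases') metis
    have "2 * pi * of_int n / a > 0" "a * (2 * pi * of_int n / a) = 2 * pi * of_int n"
      using pos False mn(2) by auto
    moreover have "b * (2 * pi * of_int n / a) = 2 * pi * of_int m"
      using mn False by (simp add: field_simps)
    ultimately show ?thesis by blast
  qed
  then show ?thesis unfolding periodic_def a_b_def using one_param_periodic by metis
qed

text \<open>The equation says \<open>exp(l u) = exp(- l v)\<close>. Comparing the components along the independent
  vectors \<open>1\<close>, \<open>u\<close>, \<open>v\<close> kills both sines, so \<open>l \<bar>u\<bar>\<close> and \<open>l \<bar>v\<bar>\<close> lie in \<open>\<pi> \<int>\<close>. A single return to the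
  initial point therefore suffices for rationality.\<close>

lemma one_param_product_eq_1D:
  assumes u: "u \<in> su2" and v: "v \<in> su2" and l: "l > 0"
    and indep: "\<And>a b. a *\<^sub>R u + b *\<^sub>R v = 0 \<Longrightarrow> a = 0 \<and> b = 0"
    and eq: "one_param u l ** one_param v l = mat 1"
  shows "sqrt (ip v v) / sqrt (ip u u) \<in> \<rat>"
proof -
  define a b where "a = sqrt (ip u u)" "b = sqrt (ip v v)"
  have "u \<noteq> 0" "v \<noteq> 0" using indep[of 1 0] indep[of 0 1] by auto
  then have ab: "a \<noteq> 0" "b \<noteq> 0" using ip_pos[OF u] ip_pos[OF v] by (auto simp: a_b_def)
  have "one_param u l = one_param u l ** (one_param v l ** one_param v (- l))"
    by (simp add: one_param_inverse[OF v])
  also have "\<dots> = one_param v (- l)" by (simp add: matrix_mul_assoc eq)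
  finally have e: "cos (a * l) *\<^sub>R mat 1 + (sin (a * l) / a) *\<^sub>R u =
      cos (b * l) *\<^sub>R mat 1 - (sin (b * l) / b) *\<^sub>R v"
    by (simp add: one_param_def flip: a_b_def)
  \<comment> \<open>The diagonal of \<open>u\<close> and \<open>v\<close> is purely imaginary, so the real part of an entry there isolates the multiple of the identity.\<close>
  have "cos (a * l) = cos (b * l)"
    using arg_cong[OF e, of "\<lambda>A. Re (A$1$1)"] su2D(2)[OF u] su2D(2)[OF v] by (simp add: mat2_simps)
  then have "(sin (a * l) / a) *\<^sub>R u + (sin (b * l) / b) *\<^sub>R v = 0" using e by simp
  then have "sin (a * l) = 0" "sin (b * l) = 0" using indep ab by fastforce+
  then obtain m n where mn: "a * l = of_int m * pi" "b * l = of_int n * pi"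
    by (auto simp: sin_zero_iff_int2)
  have "b / a = (b * l) / (a * l)" using l by simp
  also have "\<dots> = of_int n / of_int m" unfolding mn by simp
  finally show ?thesis by (simp add: a_b_def)
qed

section \<open>The velocity of a magnetic curve\<close>

text \<open>The inverse of a matrix of determinant one is its adjugate; in \<^const>\<open>SU2\<close> it is also the
  conjugate transpose. The point of the result is that these conditions are real-linear, so that
  they pass to the derivative of a curve.\<close>

lemma SU2_entries:
  assumes "p \<in> SU2" shows "p$2$2 = cnj (p$1$1)" "p$2$1 = - cnj (p$1$2)"
proof -
  have a: "adj p ** p = mat 1" and d: "p$1$1 * p$2$2 - p$1$2 * p$2$1 = 1"
    using SU2D[OF assms] assms by (auto simp: SU2_def det_2)
  \<comment> \<open>the adjugate of \<open>p\<close>\<close>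
  define J :: mat2 where "J = (\<chi> i j. if i = 1 then (if j = 1 then p$2$2 else - p$1$2) else (if j = 1 then - p$2$1 else p$1$1))"
  have J: "J$1$1 = p$2$2" "J$1$2 = - p$1$2" "J$2$1 = - p$2$1" "J$2$2 = p$1$1"
    by (auto simp: J_def)
  have "p ** J = mat 1" using d by (simp add: mat2_simps J mult.commute)
  then have "adj p = J" using a by (metis matrix_mul_assoc matrix_mul_lid matrix_mul_rid)
  then have "adj p $ 1 $ 1 = J $ 1 $ 1" "adj p $ 1 $ 2 = J $ 1 $ 2" "adj p $ 2 $ 1 = J $ 2 $ 1" by auto
  then show "p$2$2 = cnj (p$1$1)" "p$2$1 = - cnj (p$1$2)"
    by (auto simp: J adj_nth)
qed

text \<open>Differentiating \<open>c\<^sup>* c = 1\<close> shows that \<open>c\<^sup>* V\<close> is skew-Hermitian. Differentiating the linear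
  relations between the entries of \<open>c\<close> makes the diagonal entries of \<open>c\<^sup>* V\<close> conjugate to each
  other; being imaginary, they add up to zero.\<close>

lemma SU2_curve_velocity:
  assumes c: "\<And>s. c s \<in> SU2" and d: "(c has_vector_derivative V) (at s)"
  shows "adj (c s) ** V \<in> su2"
proof -
  let ?x = "adj (c s) ** V"
  have "((\<lambda>s. adj (c s) ** c s) has_vector_derivative adj (c s) ** V + adj V ** c s) (at s)"
    by (rule mat2_mult.has_vector_derivative[OF bounded_linear.has_vector_derivative[OF bounded_linear_adj d] d])
  moreover have "((\<lambda>s. adj (c s) ** c s) has_vector_derivative 0) (at s)"
    using SU2D[OF c] by simp
  ultimately have "adj (c s) ** V + adj V ** c s = 0" by (rule vector_derivative_unique_at)
  moreover have "adj (adj A) = A" for A by (simp add: mat2_simps)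
  ultimately have skew: "adj ?x = - ?x" by (simp add: adj_mult eq_neg_iff_add_eq_0 add.commute)
  define h where "h A = (A$2$2 - cnj (A$1$1), A$2$1 + cnj (A$1$2))" for A :: mat2
  have "bounded_linear h"
    by (rule linear_conv_bounded_linear[THEN iffD1]) (auto simp: linear_iff h_def algebra_simps)
  then have "((\<lambda>s. h (c s)) has_vector_derivative h V) (at s)"
    by (rule bounded_linear.has_vector_derivative[OF _ d])
  moreover have "h (c s) = 0" for s using SU2_entries[OF c] by (simp add: h_def zero_prod_def)
  ultimately have "((\<lambda>s. 0) has_vector_derivative h V) (at s)" by simp
  then have "h V = 0" by (rule vector_derivative_unique_at) (rule has_vector_derivative_const)
  then have V: "V$2$2 = cnj (V$1$1)" "V$2$1 = - cnj (V$1$2)"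
    by (auto simp: h_def zero_prod_def add_eq_0_iff)
  have "?x$2$2 = cnj (?x$1$1)" using V SU2_entries[OF c, of s] by (simp add: mat2_simps)
  moreover have "?x$2$2 = - cnj (?x$2$2)" using arg_cong[OF skew, of "\<lambda>A. A$2$2"] by (simp add: adj_nth)
  ultimately have "trace ?x = 0" by (simp add: trace_mat2)
  with skew show ?thesis by (simp add: su2_def)
qed

text \<open>The covariant derivative sums over the set \<open>{E1, E2, E3}\<close>, so coinciding fields would be
  counted only once.\<close>

lemma frame_distinct: "E1 \<noteq> E2" "E1 \<noteq> E3" "E2 \<noteq> E3"
proof -
  have "bi \<noteq> bj" "bi \<noteq> bk" "bj \<noteq> bk" by (auto simp: mat2_simps)
  moreover have "left_invariant_field X (mat 1) = X" for X by (simp add: left_invariant_field_def)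
  ultimately show "E1 \<noteq> E2" "E1 \<noteq> E3" "E2 \<noteq> E3" unfolding E1_def E2_def E3_def by metis+
qed

lemma smooth_curve:
  fixes c :: "real \<Rightarrow> mat2"
  assumes "smooth c"
  shows "(c has_vector_derivative vector_derivative c (at s)) (at s)"
    "(\<lambda>s. vector_derivative c (at s)) differentiable at s"
proof -
  have d: "c differentiable at s" for s using assms by (rule smooth_differentiable)
  then show 1: "(c has_vector_derivative vector_derivative c (at s)) (at s)" for s
    by (simp add: vector_derivative_works)
  have "frechet_derivative c (at s) 1 = vector_derivative c (at s)" for s
    using frechet_derivative_at[OF 1[of s, unfolded has_vector_derivative_def], symmetric] by simp
  moreover have "C_k (Suc (Suc 0)) c" using assms by (simp only: smooth_def)
  then have "(\<lambda>s. frechet_derivative c (at s) 1) differentiable at s" by simp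
  ultimately show "(\<lambda>s. vector_derivative c (at s)) differentiable at s" by simp
qed

text \<open>Euler's equation for the curve: in the covariant derivative, the connection terms of the
  three frame fields add up to \<open>[x, x] / 2 = 0\<close>, which leaves \<open>c\<^sup>* \<nabla>\<^bsub>c'\<^esub> c' = x'\<close>. The Lorentz
  force is half the bracket with \<open>q k\<close>.\<close>

lemma velocity_equation:
  assumes n: "levi_civita nabla" and m: "normal_magnetic_curve nabla q c"
  defines "x \<equiv> \<lambda>s. adj (c s) ** vector_derivative c (at s)"
  shows "(x has_vector_derivative (q/2) *\<^sub>R (x s ** bk - bk ** x s)) (at s)"
proof -
  have c: "c s \<in> SU2" for s using m by (auto simp: normal_magnetic_curve_def)
  have sm: "smooth c" using m by (auto simp: normal_magnetic_curve_def)
  have x: "x s \<in> su2" for s unfolding x_def by (rule SU2_curve_velocity[OF c smooth_curve(1)[OF sm]])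
  have "x differentiable at s"
  proof -
    have "((\<lambda>s. vector_derivative c (at s)) has_vector_derivative
        vector_derivative (\<lambda>s. vector_derivative c (at s)) (at s)) (at s)"
      using smooth_curve(2)[OF sm] by (simp add: vector_derivative_works)
    from mat2_mult.has_vector_derivative[OF bounded_linear.has_vector_derivative[OF bounded_linear_adj smooth_curve(1)[OF sm]] this]
    show ?thesis unfolding x_def by (rule differentiableI_vector)
  qed
  then obtain x' where x': "(x has_vector_derivative x') (at s)" by (auto simp: vector_derivative_works)
  have coord: "((\<lambda>s. ip (x s) e) has_real_derivative ip x' e) (at s)" for e
    using bounded_linear.has_vector_derivative[OF ip.bounded_linear_left x', of e]
    by (simp add: has_real_derivative_iff_has_vector_derivative)
  have proj: "((\<lambda>s. su2_proj (x s)) has_vector_derivative su2_proj x') (at s)"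
    by (rule bounded_linear.has_vector_derivative[OF bounded_linear_su2_proj x'])
  have x'p: "su2_proj x' = x'"
    using vector_derivative_unique_at[OF proj] x' x by (simp add: su2_proj_eq)
  have g: "gmetric (c s) (vector_derivative c (at s)) (left_invariant_field e (c s)) = ip (x s) e" for s e
    by (simp add: gmetric_def left_invariant_field_def SU2_cancel[OF c] x_def)
  have summand: "deriv (\<lambda>s. gmetric (c s) (vector_derivative c (at s)) (left_invariant_field e (c s))) s *\<^sub>R
      left_invariant_field e (c s) + gmetric (c s) (vector_derivative c (at s)) (left_invariant_field e (c s)) *\<^sub>R
      nabla (left_invariant_field (adj (c s) ** vector_derivative c (at s))) (left_invariant_field e) (c s)
     = c s ** (ip x' e *\<^sub>R e + (1/2) *\<^sub>R (x s ** (ip (x s) e *\<^sub>R e) - (ip (x s) e *\<^sub>R e) ** x s))"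
    if "e \<in> su2" for e
    unfolding g DERIV_imp_deriv[OF coord]
      levi_civita_left_invariant[OF n x[unfolded x_def] that c]
    by (simp add: left_invariant_field_def x_def mat2_mult.add_right mat2_mult.diff_right
        mat2_mult.scaleR_right mat2_mult.scaleR_left scaleR_diff_right)
  have "covariant_derivative nabla c (\<lambda>t. vector_derivative c (at t)) s =
     c s ** (su2_proj x' + (1/2) *\<^sub>R (x s ** su2_proj (x s) - su2_proj (x s) ** x s))"
    unfolding covariant_derivative_def using frame_distinct
    by (simp add: E1_def E2_def E3_def)
      (simp add: summand basis_in_su2 su2_proj_def mat2_mult.add_left mat2_mult.add_right
       mat2_mult.diff_right scaleR_add_right scaleR_diff_right mat2_mult.scaleR_right)
  also have "\<dots> = c s ** x'" by (simp add: x'p su2_proj_eq[OF x])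
  finally have "c s ** x' = q *\<^sub>R phi (c s) (vector_derivative c (at s))"
    using m by (simp add: normal_magnetic_curve_def)
  also have "\<dots> = c s ** (q *\<^sub>R (ip (x s) bj *\<^sub>R bi - ip (x s) bi *\<^sub>R bj))"
    unfolding phi_def E1_def E2_def g
    by (simp add: left_invariant_field_def mat2_mult.diff_right mat2_mult.scaleR_right)
  finally have "x' = q *\<^sub>R (ip (x s) bj *\<^sub>R bi - ip (x s) bi *\<^sub>R bj)" by (simp add: SU2_cancel[OF c])
  also have "\<dots> = (q/2) *\<^sub>R (x s ** bk - bk ** x s)"
    using su2D[OF x, of s] by (auto simp: mat2_simps ip_def complex_eq_iff algebra_simps)
  finally show ?thesis using x' by simp
qed

lemma zero_derivative_imp_const:
  fixes f :: "real \<Rightarrow> 'a::real_normed_vector"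
  assumes "\<And>s. (f has_vector_derivative 0) (at s)"
  shows "f s = f 0"
proof -
  obtain c where "\<And>x. x \<in> UNIV \<Longrightarrow> f x = c"
    using has_vector_derivative_zero_constant[of UNIV f] assms by auto
  then show ?thesis by simp
qed

text \<open>Two conserved quantities replace the uniqueness theorem for ordinary differential equations:
  \<open>exp(s v) x(s) exp(- s v)\<close> by the velocity equation, and then
  \<open>c(s) exp(- s v) exp(- s u)\<close> because \<open>x exp(- s v) = exp(- s v) x(0)\<close> and \<open>x(0) = u + v\<close>.\<close>

lemma magnetic_curve_explicit:
  assumes n: "levi_civita nabla" and m: "normal_magnetic_curve nabla q c"
  defines "v \<equiv> (q/2) *\<^sub>R bk"
  defines "u \<equiv> adj (c 0) ** vector_derivative c (at 0) - v"
  shows "c s = c 0 ** (one_param u s ** one_param v s)"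
proof -
  define x where "x s = adj (c s) ** vector_derivative c (at s)" for s
  have c: "c s \<in> SU2" for s using m by (auto simp: normal_magnetic_curve_def)
  have sm: "smooth c" using m by (auto simp: normal_magnetic_curve_def)
  have x: "x s \<in> su2" for s unfolding x_def by (rule SU2_curve_velocity[OF c smooth_curve(1)[OF sm]])
  have v: "v \<in> su2" unfolding v_def by (intro su2_scaleR basis_in_su2)
  have u: "u \<in> su2" using su2_diff[OF x v, of 0] by (simp add: u_def x_def)
  let ?A = "one_param v" and ?B = "one_param u"
  have c': "(c has_vector_derivative c s ** x s) (at s)" for s
    using smooth_curve(1)[OF sm, of s] by (simp add: x_def SU2_cancel[OF c])
  have x': "(x has_vector_derivative x s ** v - v ** x s) (at s)" for s
    using velocity_equation[OF n m, of s]
    by (simp add: x_def[abs_def] v_def mat2_mult.scaleR_left mat2_mult.scaleR_right scaleR_diff_right)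
  have conj: "x s ** ?A (- s) = ?A (- s) ** x 0" for s
  proof -
    have "((\<lambda>s. ?A s ** (x s ** ?A (- s))) has_vector_derivative
       ?A s ** (x s ** (- (?A (- s) ** v)) + (x s ** v - v ** x s) ** ?A (- s)) + (?A s ** v) ** (x s ** ?A (- s))) (at s)" for s
      by (intro mat2_mult.has_vector_derivative one_param_has_derivative one_param_neg_has_derivative v x')
    moreover have "?A s ** (x s ** (- (?A (- s) ** v)) + (x s ** v - v ** x s) ** ?A (- s)) + (?A s ** v) ** (x s ** ?A (- s)) = 0" for s
      by (simp add: mat2_mult.add_left mat2_mult.add_right mat2_mult.diff_left mat2_mult.diff_right
        mat2_mult.minus_right one_param_commute flip: matrix_mul_assoc)
    ultimately have "((\<lambda>s. ?A s ** (x s ** ?A (- s))) has_vector_derivative 0) (at s)" for s by simp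
    from zero_derivative_imp_const[OF this, of s]
    have "?A s ** (x s ** ?A (- s)) = x 0" by (simp add: one_param_0)
    then have "?A (- s) ** x 0 = (?A (- s) ** ?A (- (- s))) ** (x s ** ?A (- s))"
      by (simp flip: matrix_mul_assoc)
    then show ?thesis by (simp only: one_param_inverse[OF v] matrix_mul_lid)
  qed
  have "((\<lambda>s. c s ** (?A (- s) ** ?B (- s))) has_vector_derivative
      c s ** (?A (- s) ** (- (?B (- s) ** u)) + (- (?A (- s) ** v)) ** ?B (- s)) + (c s ** x s) ** (?A (- s) ** ?B (- s))) (at s)" for s
    by (intro mat2_mult.has_vector_derivative one_param_neg_has_derivative u v c')
  moreover have "c s ** (?A (- s) ** (- (?B (- s) ** u)) + (- (?A (- s) ** v)) ** ?B (- s)) + (c s ** x s) ** (?A (- s) ** ?B (- s)) = 0" (is "?L = 0") for s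
  proof -
    have "?L = c s ** ((x s ** ?A (- s) - ?A (- s) ** (u + v)) ** ?B (- s))"
      by (simp add: mat2_mult.add_left mat2_mult.add_right mat2_mult.diff_left mat2_mult.diff_right
        mat2_mult.minus_right mat2_mult.minus_left one_param_commute flip: matrix_mul_assoc)
    also have "u + v = x 0" by (simp add: u_def x_def)
    finally show ?thesis by (simp add: conj)
  qed
  ultimately have "((\<lambda>s. c s ** (?A (- s) ** ?B (- s))) has_vector_derivative 0) (at s)" for s by simp
  from zero_derivative_imp_const[OF this, of s]
  have "c s ** (?A (- s) ** ?B (- s)) = c 0" by (simp add: one_param_0)
  then have "c 0 ** (?B s ** ?A s) = (c s ** (?A (- s) ** ?B (- s))) ** (?B s ** ?A s)" by simp
  also have "\<dots> = c s ** (?A (- s) ** (?B (- s) ** ?B (- (- s))) ** ?A s)"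
    by (simp flip: matrix_mul_assoc)
  also have "\<dots> = c s ** (?A (- s) ** ?A (- (- s)))" by (simp only: one_param_inverse[OF u]) simp
  also have "\<dots> = c s" by (simp only: one_param_inverse[OF v]) simp
  finally show ?thesis by simp
qed

theorem theorem6p1:
  fixes nabla :: "(mat2 \<Rightarrow> mat2) \<Rightarrow> (mat2 \<Rightarrow> mat2) \<Rightarrow> mat2 \<Rightarrow> mat2"
    and \<gamma> :: "real \<Rightarrow> mat2"
    and q \<theta> :: real
  assumes "levi_civita nabla"
    and "q \<noteq> 0"
    and "normal_magnetic_curve nabla q \<gamma>"
    and "has_contact_angle \<gamma> \<theta>"
  shows "(sin \<theta> \<noteq> 0 \<longrightarrow> (periodic \<gamma> \<longleftrightarrow> q / sqrt (q\<^sup>2 - 4 * q * cos \<theta> + 4) \<in> \<rat>)) \<and>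
    (q / sqrt (q\<^sup>2 - 4 * q * cos \<theta> + 4) \<in> \<rat> \<longrightarrow> periodic \<gamma>)"
proof -
  define v where "v = (q/2) *\<^sub>R bk"
  define x where "x = adj (\<gamma> 0) ** vector_derivative \<gamma> (at 0)"
  define u where "u = x - v"
  have c: "\<gamma> s \<in> SU2" for s using assms(3) by (auto simp: normal_magnetic_curve_def)
  have sm: "smooth \<gamma>" using assms(3) by (auto simp: normal_magnetic_curve_def)
  have x: "x \<in> su2" unfolding x_def by (rule SU2_curve_velocity[OF c smooth_curve(1)[OF sm]])
  have v: "v \<in> su2" "v \<noteq> 0" unfolding v_def using \<open>q \<noteq> 0\<close> by (auto intro: su2_scaleR basis_in_su2 simp: mat2_simps)
  have u: "u \<in> su2" unfolding u_def by (rule su2_diff[OF x v(1)])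
  have xx: "ip x x = 1" using assms(3) by (simp add: normal_magnetic_curve_def gmetric_def x_def)
  have xk: "ip x bk = cos \<theta>"
    using assms(4) by (simp add: has_contact_angle_def gmetric_def xi_def E3_def left_invariant_field_def x_def SU2_cancel[OF c])
  have curve: "\<gamma> s = \<gamma> 0 ** (one_param u s ** one_param v s)" for s
    unfolding u_def v_def x_def by (rule magnetic_curve_explicit[OF assms(1,3)])
  have "\<gamma> (s + l) = \<gamma> s \<longleftrightarrow>
      one_param u (s + l) ** one_param v (s + l) = one_param u s ** one_param v s" for s l
    by (simp only: curve[of s] curve[of "s + l"] SU2_cancel[OF c])
  then have per: "periodic \<gamma> \<longleftrightarrow> periodic (\<lambda>s. one_param u s ** one_param v s)"
    by (simp add: periodic_def)
  have vv: "ip v v = (q/2)\<^sup>2"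
    by (simp add: v_def ip.scaleR_left ip.scaleR_right ip_bk_bk power2_eq_square)
  have "ip u u = (q\<^sup>2 - 4 * q * cos \<theta> + 4) / 4"
    unfolding u_def ip.diff_left ip.diff_right vv xx
    by (simp add: v_def ip.scaleR_left ip.scaleR_right xk ip_commute[of bk] power2_eq_square field_simps)
  then have "sqrt (ip u u) = sqrt (q\<^sup>2 - 4 * q * cos \<theta> + 4) / 2" by (simp only: real_sqrt_divide real_sqrt_four)
  moreover have "sqrt (ip u u) \<ge> 0" using ip_pos(1)[OF u] by simp
  ultimately have ratio: "sqrt (ip v v) / sqrt (ip u u) = \<bar>q / sqrt (q\<^sup>2 - 4 * q * cos \<theta> + 4)\<bar>"
    by (simp only: abs_divide) (simp add: vv)
  have rat: "\<bar>r\<bar> \<in> \<rat> \<longleftrightarrow> r \<in> \<rat>" for r :: real by (simp add: abs_if)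
  have "periodic \<gamma>" if "q / sqrt (q\<^sup>2 - 4 * q * cos \<theta> + 4) \<in> \<rat>"
    unfolding per by (rule periodic_product_if[OF u v]) (simp only: ratio rat that)
  moreover have "q / sqrt (q\<^sup>2 - 4 * q * cos \<theta> + 4) \<in> \<rat>" if "sin \<theta> \<noteq> 0" "periodic \<gamma>"
  proof -
    \<comment> \<open>A dependence of \<open>u\<close> and \<open>v\<close> makes the unit vectors \<open>x\<close> and \<open>k\<close> parallel, so that
      \<open>cos \<theta>\<close>, their inner product, would be \<open>1\<close> or \<open>-1\<close>.\<close>
    have indep: "a = 0 \<and> b = 0" if "a *\<^sub>R u + b *\<^sub>R v = 0" for a b
    proof -
      define t where "t = (a - b) * (q/2)"
      have e: "a *\<^sub>R x = t *\<^sub>R bk"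
        using that by (simp add: t_def u_def v_def algebra_simps diff_divide_distrib)
      have "a = ip (a *\<^sub>R x) x" by (simp add: ip.scaleR_left xx)
      then have at: "a = t * cos \<theta>" by (simp add: e ip.scaleR_left ip_commute[of bk] xk)
      have "t = ip (a *\<^sub>R x) bk" by (simp add: e ip.scaleR_left ip_bk_bk)
      then have "t = a * cos \<theta>" by (simp add: ip.scaleR_left xk)
      with at have "t = t * (cos \<theta>)\<^sup>2" by (metis mult.assoc power2_eq_square)
      then have "t * (1 - (cos \<theta>)\<^sup>2) = 0" by (simp add: right_diff_distrib)
      then have "t = 0" using \<open>sin \<theta> \<noteq> 0\<close> by (simp flip: sin_squared_eq)
      moreover from this have "a = 0" using at by simp
      ultimately show ?thesis using \<open>q \<noteq> 0\<close> t_def by simp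
    qed
    obtain l where l: "l > 0" "one_param u (0 + l) ** one_param v (0 + l) = one_param u 0 ** one_param v 0"
      using \<open>periodic \<gamma>\<close>[unfolded per] unfolding periodic_def by metis
    then have "one_param u l ** one_param v l = mat 1" by (simp add: one_param_0)
    from one_param_product_eq_1D[OF u v(1) l(1) indep this] show ?thesis by (simp only: ratio rat)
  qed
  ultimately show ?thesis by blast
qed

end
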